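(* For every integer $n\ge 3$, $$\frac{1}{n!}\sum_{\sigma \in S_n} \prod_{i=1}^n \mathbf{a}_{\sigma(i);n} \mathbf{a}_{\sigma(i);n}^T = - \lambda(n)\, 2^{-n}\, \mathbf{I},$$ where $\mathbf{I}$ is the $2\times 2$ identity matrix. Moreover $\lambda(n)\le 1$ for all $n\ge 3$, and $\lambda(n)=\mathcal{O}(n^{-1})$ as $n\to\infty$.
   Context: For $n\ge 3$ and $1\le k\le n$ define the vectors $\mathbf{a}_{k;n} = \left(\cos(k\pi/n),\ \sin(k\pi/n)\right)^T\in\mathbb{R}^2$. $S_n$ is the group of permutations of $\{1,\dots,n\}$. Define $$\lambda(n) := -\,{}_3F_2\left[\begin{array}{c} 1,\ -n/2+1/2,\ -n/2\\ 1/2,\ -n+1 \end{array}; 1\right] = -\sum_{k=0}^{\lfloor n/2\rfloor} \frac{(1)_k\,(-\tfrac n2+\tfrac12)_k\,(-\tfrac n2)_k}{(\tfrac12)_k\,(-n+1)_k\,k!},$$ where $(a)_k=a(a+1)\cdots(a+k-1)$, $(a)_0=1$ (the series terminates at $k=\lfloor n/2\rfloor$). *)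

theory Defs
  imports "HOL-Analysis.Analysis" "HOL-Library.Landau_Symbols"
    "HOL-Combinatorics.Permutations"
begin

definition avec :: "nat \<Rightarrow> nat \<Rightarrow> real^2" where
  "avec n k = vector [cos (real k * pi / real n), sin (real k * pi / real n)]"

definition outer_self :: "real^2 \<Rightarrow> real^2^2" where
  "outer_self v = (columnvector v :: real^1^2) ** transpose (columnvector v)"

(* M 1 ** M 2 ** ... ** M n in this order. The type class multiplication on real^2^2 is
   componentwise, so prod_list would not denote the matrix product. *)
definition mat_prod_upto :: "nat \<Rightarrow> (nat \<Rightarrow> real^2^2) \<Rightarrow> real^2^2" where
  "mat_prod_upto n M = foldr (**) (map M [1..<Suc n]) (mat 1)"

definition lam :: "nat \<Rightarrow> real" where
  "lam n = - (\<Sum>k = 0..n div 2.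
      pochhammer 1 k * pochhammer (- (real n / 2) + 1/2) k * pochhammer (- (real n / 2)) k /
      (pochhammer (1/2) k * pochhammer (- real n + 1) k * fact k))"

(* The coefficients of the 3F2 series beyond n div 2 vanish, as a numerator factor is zero
   (from index n on, the lower parameter 1 - n also produces 0/0, which is 0 in HOL). *)
lemma lam_eq_3F2:
  "lam n = - eval_fps (fps_hypergeo [1, - (real n / 2) + 1/2, - (real n / 2)]
                                    [1/2, - real n + 1] 1) 1"
proof -
  let ?F = "fps_hypergeo [1, - (real n / 2) + 1/2, - (real n / 2)] [1/2, - real n + 1] 1"
  have zero: "fps_nth ?F k * 1 ^ k = 0" if "k \<notin> {0..n div 2}" for k
  proof -
    have k: "n div 2 < k" using that by simp
    have "pochhammer (- (real n / 2) + 1/2) k = 0 \<or> pochhammer (- (real n / 2)) k = 0"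
    proof (cases "even n")
      case True
      then have "- (real n / 2) = - real (n div 2)" by (simp add: real_of_nat_div)
      then show ?thesis using k by (metis pochhammer_eq_0_iff)
    next
      case False
      then have "- (real n / 2) + 1/2 = - real (n div 2)"
        by (auto elim!: oddE simp: field_simps)
      then show ?thesis using k by (metis pochhammer_eq_0_iff)
    qed
    then show ?thesis by auto
  qed
  have "eval_fps ?F 1 = (\<Sum>k = 0..n div 2. fps_nth ?F k * 1 ^ k)"
    unfolding eval_fps_def by (rule suminf_finite) (use zero in auto)
  then show ?thesis by (simp add: lam_def)
qed

end

(* Identify the plane with the complex numbers and let w_k = exp(2 pi i k/n). Then a_k a_k^T is
   z |-> (z + w_k cnj z)/2, so expanding the products and summing over all orderings leaves the
   coefficients of s^k t^k (linear part) and s^(k+1) t^k (conjugate-linear part) of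
   prod_k (1 + s w_k + t cnj w_k), weighted by factorials. This product equals
   L_n(st) - (-s)^n - (-t)^n with the Lucas-type polynomials L_0 = 2, L_1 = 1,
   L_(n+2) = L_(n+1) - x L_n; hence the conjugate-linear part vanishes, and the explicit
   coefficients of L_n turn the linear part into the terminating 3F2 series.
   The bounds follow from lam(n+1) = (2 + (n+1) lam(n)) / (2n). *)

theory Submission
  imports Defs "HOL-Combinatorics.Multiset_Permutations" "HOL-Computational_Algebra.Polynomial"
begin

section \<open>Real 2x2 matrices as real-linear maps of the complex plane\<close>

text \<open>The real matrix of \<open>z \<mapsto> p z + q cnj z\<close>.\<close>

definition cmat :: "complex \<Rightarrow> complex \<Rightarrow> real^2^2" where
  "cmat p q = vector [vector [Re p + Re q, Im q - Im p], vector [Im p + Im q, Re p - Re q]]"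

lemma cmat_mult: "cmat p q ** cmat p' q' = cmat (p * p' + q * cnj q') (p * q' + q * cnj p')"
  by (simp add: cmat_def vec_eq_iff matrix_matrix_mult_def sum_2 forall_2 algebra_simps)

lemma cmat_add: "cmat p q + cmat p' q' = cmat (p + p') (q + q')"
  by (simp add: cmat_def vec_eq_iff forall_2)

lemma cmat_scaleR: "r *\<^sub>R cmat p q = cmat (r *\<^sub>R p) (r *\<^sub>R q)"
  by (simp add: cmat_def vec_eq_iff forall_2 algebra_simps)

lemma cmat_sum: "(\<Sum>x\<in>A. cmat (f x) (g x)) = cmat (\<Sum>x\<in>A. f x) (\<Sum>x\<in>A. g x)"
proof (induction A rule: infinite_finite_induct)
  case (insert x A)
  then show ?case by (simp add: cmat_add)
qed (simp_all add: cmat_def vec_eq_iff forall_2)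

lemma cmat_one: "cmat 1 0 = mat 1"
  by (simp add: cmat_def vec_eq_iff forall_2 mat_def)

lemma matrix_mult_sum_right:
  fixes A :: "real^'n^'m" and B :: "'a \<Rightarrow> real^'p^'n"
  shows "A ** (\<Sum>x\<in>X. B x) = (\<Sum>x\<in>X. A ** B x)"
proof (induction X rule: infinite_finite_induct)
  case (insert x X)
  then show ?case by (simp add: matrix_add_ldistrib)
qed simp_all

text \<open>The matrix is the orthogonal projection onto the line at angle \<open>x\<close>, hence
  half the sum of the identity and the reflection in that line, and this reflection is z -> cis (2x)
  cnj z.\<close>

lemma outer_self_avec:
  "outer_self (avec n k) = (1/2) *\<^sub>R cmat 1 (cis (2 * pi * real k / real n))"
proof -
  define x where "x = real k * pi / real n"
  have [simp]: "2 * pi * real k / real n = 2 * x"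
    by (simp add: x_def)
  have 1: "cos x * cos x = 1/2 + cos (2 * x) / 2" "sin x * sin x = 1/2 - cos (2 * x) / 2"
    using cos_double_cos[of x] cos_double_sin[of x] by (simp_all add: power2_eq_square field_simps)
  show ?thesis
    by (simp add: outer_self_def avec_def cmat_def vec_eq_iff forall_2 matrix_matrix_mult_def
        columnvector_def transpose_def 1 sin_double flip: x_def)
qed

section \<open>Sums over permutations as sums over lists\<close>

text \<open>Lists make a recursion on the first entry available. Surjectivity follows by counting:
  the map is injective and both sets have the same cardinality.\<close>

lemma bij_betw_permutes_permutations_of_set:
  assumes "distinct xs"
  shows "bij_betw (\<lambda>\<sigma>. map \<sigma> xs) {\<sigma>. \<sigma> permutes set xs} (permutations_of_set (set xs))"
  unfolding bij_betw_def
proof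
  show inj: "inj_on (\<lambda>\<sigma>. map \<sigma> xs) {\<sigma>. \<sigma> permutes set xs}"
  proof (rule inj_onI, rule ext)
    fix \<sigma> \<tau> x
    assume a: "\<sigma> \<in> {\<sigma>. \<sigma> permutes set xs}" "\<tau> \<in> {\<sigma>. \<sigma> permutes set xs}" "map \<sigma> xs = map \<tau> xs"
    show "\<sigma> x = \<tau> x"
      using a by (cases "x \<in> set xs") (auto simp: permutes_not_in)
  qed
  have "(\<lambda>\<sigma>. map \<sigma> xs) ` {\<sigma>. \<sigma> permutes set xs} \<subseteq> permutations_of_set (set xs)"
    using assms by (auto simp: permutes_image distinct_map permutes_in_image
        intro!: permutations_of_setI intro: permutes_inj_on)
  then show "(\<lambda>\<sigma>. map \<sigma> xs) ` {\<sigma>. \<sigma> permutes set xs} = permutations_of_set (set xs)"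
    by (rule card_subset_eq[rotated]) (simp_all add: card_image inj card_permutations)
qed

lemma sum_permutations_of_set_Cons:
  assumes "finite U" "U \<noteq> {}"
  shows "(\<Sum>xs\<in>permutations_of_set U. f xs)
       = (\<Sum>u\<in>U. \<Sum>xs\<in>permutations_of_set (U - {u}). f (u # xs))"
proof -
  have "(\<Sum>xs\<in>permutations_of_set U. f xs)
      = (\<Sum>u\<in>U. \<Sum>xs\<in>(#) u ` permutations_of_set (U - {u}). f xs)"
    unfolding permutations_of_set_nonempty[OF assms(2)] using assms(1)
    by (intro sum.UNION_disjoint) auto
  then show ?thesis
    by (simp add: sum.reindex)
qed

section \<open>Coefficients of the product of trinomials\<close>

text \<open>The coefficient of \<open>s\<^sup>a t\<^sup>b\<close> in the product of the \<open>1 + s w u + t cnj (w u)\<close>;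
  \<open>s\<close> is the outer variable.\<close>

definition esym :: "('a \<Rightarrow> complex) \<Rightarrow> 'a set \<Rightarrow> nat \<Rightarrow> nat \<Rightarrow> complex" where
  "esym w U a b = poly.coeff (poly.coeff (\<Prod>u\<in>U. [:[:1, cnj (w u):], [:w u:]:]) a) b"

lemma esym_empty: "esym w {} a b = (if a = 0 \<and> b = 0 then 1 else 0)"
  by (simp add: esym_def)

lemma esym_insert:
  assumes "finite U" "u \<notin> U"
  shows "esym w (insert u U) a b = esym w U a b
    + (if a = 0 then 0 else w u * esym w U (a - 1) b)
    + (if b = 0 then 0 else cnj (w u) * esym w U a (b - 1))"
  using assms
  by (auto simp: esym_def coeff_pCons smult_add_right split: nat.splits)

text \<open>Conjugation exchanges \<open>w u\<close> and \<open>cnj (w u)\<close>, hence the roles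
  of the two variables.\<close>

lemma cnj_esym: "finite U \<Longrightarrow> cnj (esym w U a b) = esym w U b a"
  by (induction U arbitrary: a b rule: finite_induct)
    (auto simp: esym_empty esym_insert)

lemma esym_eq_0:
  assumes "finite U" "card U < a"
  shows "esym w U a b = 0"
proof -
  let ?f = "\<lambda>u. [:[:1, cnj (w u):], [:w u:]:]"
  have "degree (prod ?f U) \<le> sum (degree \<circ> ?f) U"
    using assms(1) by (rule degree_prod_sum_le)
  also have "\<dots> \<le> (\<Sum>u\<in>U. 1)"
    by (rule sum_mono) simp
  finally show ?thesis
    using assms(2) by (simp add: esym_def coeff_eq_0)
qed

text \<open>Both sides are the same coefficient of the derivative in the outer variable; the product
  rule yields the left one.\<close>

lemma sum_weight_esym:
  "(\<Sum>u\<in>U. w u * esym w (U - {u}) a b) = of_nat (Suc a) * esym w U (Suc a) b"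
proof -
  let ?f = "\<lambda>u. [:[:1, cnj (w u):], [:w u:]:]"
  have "poly.coeff (poly.coeff (pderiv (prod ?f U)) a) b
      = (\<Sum>u\<in>U. w u * esym w (U - {u}) a b)"
    by (simp add: pderiv_prod pderiv_pCons esym_def coeff_sum)
  then show ?thesis
    by (simp add: coeff_pderiv esym_def of_nat_poly)
qed

lemma sum_cnj_weight_esym:
  assumes "finite U"
  shows "(\<Sum>u\<in>U. cnj (w u) * esym w (U - {u}) a b) = of_nat (Suc b) * esym w U a (Suc b)"
proof -
  have "(\<Sum>u\<in>U. cnj (w u) * esym w (U - {u}) a b) = cnj (\<Sum>u\<in>U. w u * esym w (U - {u}) b a)"
    using assms by (simp add: cnj_esym)
  then show ?thesis
    unfolding sum_weight_esym using assms by (simp add: cnj_esym)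
qed

text \<open>Each term of \<open>esym w U a b\<close> uses \<open>a + b\<close> elements of
  \<open>U\<close> and survives the removal of any other element. The difference is taken in the
  complex numbers, so it is not truncated.\<close>

lemma sum_esym_remove:
  assumes "finite U"
  shows "(\<Sum>u\<in>U. esym w (U - {u}) a b) = (of_nat (card U) - of_nat a - of_nat b) * esym w U a b"
proof -
  have "of_nat (card U) * esym w U a b = (\<Sum>u\<in>U. esym w (insert u (U - {u})) a b)"
    by (simp add: insert_absorb)
  also have "\<dots> = (\<Sum>u\<in>U. esym w (U - {u}) a b
    + (if a = 0 then 0 else w u * esym w (U - {u}) (a - 1) b)
    + (if b = 0 then 0 else cnj (w u) * esym w (U - {u}) a (b - 1)))"
    using assms by (intro sum.cong refl esym_insert) auto
  also have "\<dots> = (\<Sum>u\<in>U. esym w (U - {u}) a b) + of_nat a * esym w U a b + of_nat b * esym w U a b"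
    using sum_weight_esym[where w=w and U=U and a="a-1" and b=b]
      sum_cnj_weight_esym[OF assms, of w a "b-1"]
    by (cases a; cases b) (simp_all add: sum.distrib del: of_nat_Suc)
  finally show ?thesis
    by (simp add: algebra_simps)
qed

section \<open>The sum over all orderings in terms of these coefficients\<close>

text \<open>Expanding a composition of maps z -> z + w cnj z gives products whose factors are
  alternately plain and conjugated, starting with a plain one. Given \<open>k\<close> factors of
  each kind, \<open>fact k ^ 2\<close> of their \<open>fact (2 * k)\<close> relative orders
  alternate in this way. The cutoff \<open>N\<close> does not depend on \<open>U\<close>, so that
  the sums for \<open>U\<close> and \<open>U - {u}\<close> have equal range.\<close>

definition lin_coeff :: "('a \<Rightarrow> complex) \<Rightarrow> nat \<Rightarrow> 'a set \<Rightarrow> complex" where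
  "lin_coeff w N U = (\<Sum>k\<le>N. of_real (fact k ^ 2 / fact (2 * k)) * esym w U k k)"

text \<open>The same count with \<open>Suc k\<close> plain and \<open>k\<close> conjugated
  factors.\<close>

definition antilin_coeff :: "('a \<Rightarrow> complex) \<Rightarrow> nat \<Rightarrow> 'a set \<Rightarrow> complex" where
  "antilin_coeff w N U =
     (\<Sum>k\<le>N. of_real (fact k * fact (Suc k) / fact (2 * k + 1)) * esym w U (Suc k) k)"

text \<open>This is the linear part of splitting off the first factor of an ordering. At index
  \<open>k\<close> the factor \<open>card U\<close> arises as (\<open>card U\<close> - 2k) + 2k: the
  first part from removing an element, the second from the conjugate-linear coefficients, whose
  index shifts by one.\<close>

lemma lin_coeff_rec:
  assumes "finite U" "card U \<le> N"
  shows "(\<Sum>u\<in>U. lin_coeff w N (U - {u}) + w u * cnj (antilin_coeff w N (U - {u})))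
       = of_nat (card U) * lin_coeff w N U"
proof -
  let ?a = "\<lambda>k. complex_of_real (fact k ^ 2 / fact (2 * k))"
  let ?b = "\<lambda>k. complex_of_real (fact k * fact (Suc k) / fact (2 * k + 1))"
  have "(\<Sum>u\<in>U. lin_coeff w N (U - {u})) = (\<Sum>k\<le>N. ?a k * (\<Sum>u\<in>U. esym w (U - {u}) k k))"
    unfolding lin_coeff_def sum_distrib_left by (rule sum.swap)
  also have "\<dots> = (\<Sum>k\<le>N. ?a k * ((of_nat (card U) - 2 * of_nat k) * esym w U k k))"
    unfolding sum_esym_remove[OF assms(1)] by (simp add: algebra_simps)
  finally have 1: "(\<Sum>u\<in>U. lin_coeff w N (U - {u})) = \<dots>" .
  have "(\<Sum>u\<in>U. w u * cnj (antilin_coeff w N (U - {u})))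
      = (\<Sum>u\<in>U. \<Sum>k\<le>N. ?b k * (w u * esym w (U - {u}) k (Suc k)))"
    using assms(1) by (simp add: antilin_coeff_def cnj_esym sum_distrib_left mult_ac)
  also have "\<dots> = (\<Sum>k\<le>N. ?b k * (\<Sum>u\<in>U. w u * esym w (U - {u}) k (Suc k)))"
    unfolding sum_distrib_left by (rule sum.swap)
  also have "\<dots> = (\<Sum>k\<le>N. ?a (Suc k) * (2 * of_nat (Suc k)) * esym w U (Suc k) (Suc k))"
  proof (rule sum.cong[OF refl])
    fix k
    have "(fact k * fact (Suc k) / fact (2 * k + 1)) * real (Suc k)
        = fact (Suc k) ^ 2 / fact (2 * Suc k) * (2 * real (Suc k))"
      by (simp add: power2_eq_square divide_simps)
    then have "?b k * of_nat (Suc k) = ?a (Suc k) * (2 * of_nat (Suc k))"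
      by (drule_tac arg_cong[where f=complex_of_real])
        (simp only: of_real_mult of_real_of_nat_eq of_real_numeral)
    then show "?b k * (\<Sum>u\<in>U. w u * esym w (U - {u}) k (Suc k))
        = ?a (Suc k) * (2 * of_nat (Suc k)) * esym w U (Suc k) (Suc k)"
      unfolding sum_weight_esym mult.assoc[symmetric] by simp
  qed
  also have "\<dots> = (\<Sum>k\<le>Suc N. ?a k * (2 * of_nat k) * esym w U k k)"
    by (subst sum.atMost_Suc_shift) simp
  \<comment> \<open>The term of index \<open>Suc N\<close> vanishes because
    \<open>card U \<le> N\<close>.\<close>
  also have "\<dots> = (\<Sum>k\<le>N. ?a k * (2 * of_nat k) * esym w U k k)"
    using assms by (simp add: esym_eq_0)
  finally have 2: "(\<Sum>u\<in>U. w u * cnj (antilin_coeff w N (U - {u}))) = \<dots>" .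
  show ?thesis
    unfolding sum.distrib 1 2 unfolding lin_coeff_def sum_distrib_left sum.distrib[symmetric]
    by (intro sum.cong refl) algebra
qed

text \<open>The conjugate-linear part of the same splitting, with \<open>card U\<close> arising as
  (\<open>card U\<close> - (2k + 1)) + (2k + 1).\<close>

lemma antilin_coeff_rec:
  assumes "finite U"
  shows "(\<Sum>u\<in>U. antilin_coeff w N (U - {u}) + w u * cnj (lin_coeff w N (U - {u})))
       = of_nat (card U) * antilin_coeff w N U"
proof -
  let ?a = "\<lambda>k. complex_of_real (fact k ^ 2 / fact (2 * k))"
  let ?b = "\<lambda>k. complex_of_real (fact k * fact (Suc k) / fact (2 * k + 1))"
  have "(\<Sum>u\<in>U. antilin_coeff w N (U - {u}))
      = (\<Sum>k\<le>N. ?b k * (\<Sum>u\<in>U. esym w (U - {u}) (Suc k) k))"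
    unfolding antilin_coeff_def sum_distrib_left by (rule sum.swap)
  also have "\<dots> = (\<Sum>k\<le>N. ?b k * ((of_nat (card U) - of_nat (2 * k + 1)) * esym w U (Suc k) k))"
    unfolding sum_esym_remove[OF assms] by (simp add: algebra_simps)
  finally have 1: "(\<Sum>u\<in>U. antilin_coeff w N (U - {u})) = \<dots>" .
  have "(\<Sum>u\<in>U. w u * cnj (lin_coeff w N (U - {u})))
      = (\<Sum>u\<in>U. \<Sum>k\<le>N. ?a k * (w u * esym w (U - {u}) k k))"
    using assms by (simp add: lin_coeff_def cnj_esym sum_distrib_left mult_ac)
  also have "\<dots> = (\<Sum>k\<le>N. ?a k * (\<Sum>u\<in>U. w u * esym w (U - {u}) k k))"
    unfolding sum_distrib_left by (rule sum.swap)
  also have "\<dots> = (\<Sum>k\<le>N. ?b k * of_nat (2 * k + 1) * esym w U (Suc k) k)"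
  proof (rule sum.cong[OF refl])
    fix k
    have "fact k ^ 2 / fact (2 * k) * real (Suc k)
        = (fact k * fact (Suc k) / fact (2 * k + 1)) * real (2 * k + 1)"
      by (simp add: power2_eq_square divide_simps)
    then have "?a k * of_nat (Suc k) = ?b k * of_nat (2 * k + 1)"
      by (metis of_real_mult of_real_of_nat_eq)
    then show "?a k * (\<Sum>u\<in>U. w u * esym w (U - {u}) k k)
        = ?b k * of_nat (2 * k + 1) * esym w U (Suc k) k"
      unfolding sum_weight_esym mult.assoc[symmetric] by simp
  qed
  finally have 2: "(\<Sum>u\<in>U. w u * cnj (lin_coeff w N (U - {u}))) = \<dots>" .
  show ?thesis
    unfolding sum.distrib 1 2 unfolding antilin_coeff_def sum_distrib_left sum.distrib[symmetric]
    by (intro sum.cong refl) algebra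
qed

text \<open>By induction on \<open>card U\<close>: after the first entry is split off, the two
  components of the matrix sum are the left sides of the two recurrences.\<close>

lemma sum_orderings_cmat:
  assumes "finite U" "card U \<le> N"
  shows "(\<Sum>xs\<in>permutations_of_set U. foldr (**) (map (\<lambda>u. (1/2) *\<^sub>R cmat 1 (w u)) xs) (mat 1))
       = (fact (card U) / 2 ^ card U) *\<^sub>R cmat (lin_coeff w N U) (antilin_coeff w N U)"
  using assms
proof (induction "card U" arbitrary: U)
  case 0
  then have [simp]: "U = {}"
    by simp
  have "lin_coeff w N {} = (\<Sum>k\<le>N. if k = 0 then 1 else 0)"
    unfolding lin_coeff_def by (rule sum.cong) (auto simp: esym_empty)
  moreover have "antilin_coeff w N {} = 0"
    by (simp add: antilin_coeff_def esym_empty)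
  ultimately show ?case
    by (simp add: cmat_one)
next
  case (Suc m)
  let ?F = "\<lambda>xs. foldr (**) (map (\<lambda>u. (1/2) *\<^sub>R cmat 1 (w u)) xs) (mat 1)"
  have ne: "U \<noteq> {}"
    using Suc by auto
  have "(\<Sum>xs\<in>permutations_of_set U. ?F xs)
      = (\<Sum>u\<in>U. (1/2) *\<^sub>R cmat 1 (w u) ** (\<Sum>xs\<in>permutations_of_set (U - {u}). ?F xs))"
    using Suc.prems(1) ne by (simp add: sum_permutations_of_set_Cons matrix_mult_sum_right)
  also have "\<dots> = (\<Sum>u\<in>U. (1/2) *\<^sub>R cmat 1 (w u) ** ((fact m / 2 ^ m) *\<^sub>R
      cmat (lin_coeff w N (U - {u})) (antilin_coeff w N (U - {u}))))"
  proof (rule sum.cong[OF refl])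
    fix u assume "u \<in> U"
    then have "card (U - {u}) = m"
      using Suc by simp
    then show "(1/2) *\<^sub>R cmat 1 (w u) ** (\<Sum>xs\<in>permutations_of_set (U - {u}). ?F xs)
      = (1/2) *\<^sub>R cmat 1 (w u) ** ((fact m / 2 ^ m) *\<^sub>R
          cmat (lin_coeff w N (U - {u})) (antilin_coeff w N (U - {u})))"
      using Suc by simp
  qed
  also have "\<dots> = (fact m / 2 ^ Suc m) *\<^sub>R
      cmat (\<Sum>u\<in>U. lin_coeff w N (U - {u}) + w u * cnj (antilin_coeff w N (U - {u})))
           (\<Sum>u\<in>U. antilin_coeff w N (U - {u}) + w u * cnj (lin_coeff w N (U - {u})))"
    by (simp add: matrix_scalar_ac cmat_mult cmat_sum
       flip: scalar_matrix_assoc scaleR_sum_right)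
  also have "\<dots> = (fact m / 2 ^ Suc m) *\<^sub>R
      cmat (of_nat (Suc m) * lin_coeff w N U) (of_nat (Suc m) * antilin_coeff w N U)"
    using Suc lin_coeff_rec[of U N w] antilin_coeff_rec[of U w N] by simp
  also have "\<dots> = (fact (Suc m) / 2 ^ Suc m) *\<^sub>R cmat (lin_coeff w N U) (antilin_coeff w N U)"
    by (simp only: cmat_scaleR scaleR_scaleR[symmetric] times_divide_eq_left[symmetric] fact_Suc)
      (simp add: scaleR_conv_of_real field_simps)
  finally show ?case
    using Suc by simp
qed

section \<open>Roots of unity and Lucas-type polynomials\<close>

text \<open>For \<open>y = 1\<close> both sides are monic of degree \<open>n\<close> in
  \<open>x\<close> and agree at the \<open>n\<close> roots of unity; any other nonzero
  \<open>y\<close> follows by scaling.\<close>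

lemma prod_diff_roots_of_unity:
  fixes x y :: complex
  assumes "n > 0"
  shows "(\<Prod>k=1..n. x - cis (2 * pi * real k / real n) * y) = x ^ n - y ^ n"
proof -
  let ?w = "\<lambda>k. cis (2 * pi * real k / real n)"
  have "(\<Prod>k=1..n. f (?w k)) = (\<Prod>z | z ^ n = 1. f z)" for f :: "complex \<Rightarrow> complex poly"
  proof -
    \<comment> \<open>Index \<open>n\<close> replaces index 0, since both give the root 1.\<close>
    have "{1..n} = insert n {1..<n}" "{..<n} = insert 0 {1..<n}"
      using assms by auto
    then have "(\<Prod>k=1..n. f (?w k)) = (\<Prod>k<n. f (?w k))"
      using assms by simp
    also have "\<dots> = (\<Prod>z | z ^ n = 1. f z)"
      using assms by (intro prod.reindex_bij_betw Complex.bij_betw_roots_unity)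
    finally show ?thesis .
  qed
  note reindex = this
  have card: "card {z::complex. z ^ n = 1} = n"
    using assms by (rule card_roots_unity_eq)
  have deg: "degree (\<Prod>z::complex | z ^ n = 1. [:- z, 1:]) = n"
    by (simp add: degree_prod_eq_sum_degree card)
  have "(\<Prod>z::complex | z ^ n = 1. [:- z, 1:]) = monom 1 n - 1"
  proof (rule poly_eqI_degree_lead_coeff)
    have "lead_coeff (\<Prod>z::complex | z ^ n = 1. [:- z, 1:]) = 1"
      by (simp add: lead_coeff_prod)
    then show "poly.coeff (\<Prod>z::complex | z ^ n = 1. [:- z, 1:]) n = poly.coeff (monom 1 n - 1) n"
      using assms by (simp add: deg)
    show "n \<le> card {z::complex. z ^ n = 1}"
      by (simp add: card)
    show "degree (monom 1 n - 1 :: complex poly) \<le> n"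
      by (intro degree_diff_le degree_monom_le) simp
    fix z :: complex
    assume z: "z \<in> {z. z ^ n = 1}"
    then show "poly (\<Prod>z | z ^ n = 1. [:- z, 1:]) z = poly (monom 1 n - 1) z"
      using assms by (simp add: poly_prod poly_monom prod_zero_iff finite_roots_unity)
  qed (simp add: deg)
  then have 1: "(\<Prod>k=1..n. z - ?w k) = z ^ n - 1" for z
    using arg_cong[OF reindex[of "\<lambda>z. [:- z, 1:]"], of "\<lambda>p. poly p z"]
    by (simp add: poly_prod poly_monom)
  show ?thesis
  proof (cases "y = 0")
    case True
    then show ?thesis using assms by simp
  next
    case False
    have "(\<Prod>k=1..n. x - ?w k * y) = (\<Prod>k=1..n. y * (x / y - ?w k))"
      using False by (intro prod.cong refl) (simp add: field_simps)
    also have "\<dots> = y ^ n * ((x / y) ^ n - 1)"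
      by (simp only: prod.distrib prod_constant card_atLeastAtMost 1) simp
    also have "\<dots> = x ^ n - y ^ n"
      using False by (simp add: field_simps)
    finally show ?thesis .
  qed
qed

text \<open>The values at -1 are the Lucas numbers.\<close>

fun lucas :: "nat \<Rightarrow> complex poly" where
  "lucas 0 = 2"
| "lucas (Suc 0) = 1"
| "lucas (Suc (Suc n)) = lucas (Suc n) - pCons 0 (lucas n)"

text \<open>Both \<open>x\<close> and \<open>y\<close> solve z^2 = z - xy, so their powers, and the
  sums of these, satisfy the recurrence of \<open>lucas\<close>.\<close>

lemma poly_lucas:
  assumes "x + y = 1"
  shows "poly (lucas n) (x * y) = x ^ n + y ^ n"
proof (induction n rule: lucas.induct)
  case (3 n)
  have y: "y = 1 - x"
    using assms by (simp add: eq_diff_eq add.commute)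
  show ?case
    by (simp add: 3) (simp add: y algebra_simps)
qed (use assms in simp_all)

text \<open>The coefficient is (-1)^k n/(n-k) binomial(n-k, k). The induction starts from the
  indices 1 and 2, because at \<open>n = 0\<close> the formula gives 0 instead of 2.\<close>

lemma coeff_lucas:
  assumes "n > 0"
  shows "poly.coeff (lucas n) k = of_real (if 2 * k \<le> n
    then (- 1) ^ k * real n * fact (n - k - 1) / (fact k * fact (n - 2 * k)) else 0)"
proof -
  let ?r = "\<lambda>n k. if 2 * k \<le> n
    then (- 1) ^ k * real n * fact (n - k - 1) / (fact k * fact (n - 2 * k)) else 0"
  let ?c = "\<lambda>n k. complex_of_real (?r n k)"
  have zero: "?c (Suc n) 0 = 1" for n
    by simp
  have "?r (n + 3) (Suc j) = ?r (n + 2) (Suc j) - ?r (n + 1) j" for n j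
  proof (cases "2 * j \<le> n + 1")
    case True
    then obtain m where m: "n + 1 = 2 * j + m"
      using le_Suc_ex by blast
    then have n3: "n + 3 = 2 * j + m + 2" and n2: "n + 2 = 2 * j + m + 1"
      by simp_all
    obtain r where r: "j + m = Suc r"
      using m by (cases "j + m") auto
    show ?thesis
    \<comment> \<open>For \<open>m = 0\<close> the term with \<open>n + 2\<close> is out of range
      and equals 0.\<close>
    proof (cases m)
      case 0
      then have "j = Suc r"
        using r by simp
      then show ?thesis
        unfolding n3 n2 m using 0 by (simp add: divide_simps) (simp add: algebra_simps)
    next
      case (Suc i)
      then have "r = j + i"
        using r by simp
      then show ?thesis
        unfolding n3 n2 m using Suc by (simp add: divide_simps) (simp add: algebra_simps)
    qed
  qed simp
  then have step: "?c (n + 3) (Suc j) = ?c (n + 2) (Suc j) - ?c (n + 1) j" for n j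
    by (simp only: of_real_diff)
  have "(\<forall>k. poly.coeff (lucas (n + 1)) k = ?c (n + 1) k) \<and>
        (\<forall>k. poly.coeff (lucas (n + 2)) k = ?c (n + 2) k)" for n
  proof (induction n)
    case 0
    have "poly.coeff (lucas 2) k = ?c 2 k" for k
    proof -
      consider "k = 0" | "k = 1" | j where "k = Suc (Suc j)"
        by (metis One_nat_def not0_implies_Suc)
      then show ?thesis
        by cases (simp_all add: numeral_2_eq_2 numeral_poly coeff_pCons split: nat.split)
    qed
    moreover have "poly.coeff (lucas 1) k = ?c 1 k" for k
      by (cases k) auto
    ultimately show ?case
      by (simp only: add_0) blast
  next
    case (Suc n)
    have "poly.coeff (lucas (n + 3)) k = ?c (n + 3) k" for k
    proof (cases k)
      case 0
      then show ?thesis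
        using Suc zero[of "n + 2"] zero[of "n + 1"] 
        by (simp add: numeral_3_eq_3 numeral_2_eq_2 del: of_real_divide)
    next
      case (Suc j)
      have "poly.coeff (lucas (n + 3)) k = poly.coeff (lucas (n + 2)) (Suc j) - poly.coeff (lucas (n + 1)) j"
        using Suc by (simp add: numeral_3_eq_3 numeral_2_eq_2)
      then show ?thesis
        using step[where n=n and j=j] Suc.IH unfolding Suc by (simp only:)
    qed
    moreover have "Suc n + 1 = n + 2" "Suc n + 2 = n + 3"
      by simp_all
    ultimately show ?case
      using Suc by (simp only:) blast
  qed
  from this[of "n - 1"] assms show ?thesis
    by (metis Suc_diff_1 Suc_eq_plus1)
qed

text \<open>A nonzero polynomial over the domain of inner polynomials has finitely many roots,
  whereas all the infinitely many constants \<open>[:s:]\<close> are roots of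
  \<open>p - q\<close>.\<close>

lemma bivariate_poly_eqI:
  fixes p q :: "'a :: {idom, ring_char_0} poly poly"
  assumes "\<And>s t. poly (poly p [:s:]) t = poly (poly q [:s:]) t"
  shows "p = q"
proof (rule ccontr)
  assume "p \<noteq> q"
  then have "finite {x. poly (p - q) x = 0}"
    by (intro poly_roots_finite) simp
  moreover have "range (\<lambda>s. [:s:]) \<subseteq> {x. poly (p - q) x = 0}"
    using assms by (auto simp: poly_eq_poly_eq_iff[symmetric] fun_eq_iff)
  moreover have "infinite (range (\<lambda>s::'a. [:s:]))"
    by (subst finite_image_iff) (auto intro: injI simp: infinite_UNIV_char_0)
  ultimately show False
    using finite_subset by blast
qed

section \<open>The hypergeometric sum: recurrence and bounds\<close>

text \<open>Multiplied by \<open>n\<close>, for positive \<open>n\<close>, this is both the summand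
  in \<open>lam\<close> and the coefficient of \<open>lucas n\<close> times the weight from
  \<open>lin_coeff\<close>.\<close>

definition hyp_term :: "nat \<Rightarrow> nat \<Rightarrow> real" where
  "hyp_term n k = (if 2 * k \<le> n
     then (- 1) ^ k * fact k * fact (n - 1 - k) / (fact (2 * k) * fact (n - 2 * k)) else 0)"

text \<open>The summands agree at index 0 and have equal ratios of successive terms. The free bound
  \<open>N\<close> allows sums for different \<open>n\<close> to be compared over one range.\<close>

lemma lam_eq_sum_hyp_term:
  assumes "n > 0" "n div 2 \<le> N"
  shows "lam n = - real n * (\<Sum>k\<le>N. hyp_term n k)"
proof -
  have summand: "pochhammer 1 k * pochhammer (- (real n / 2) + 1/2) k * pochhammer (- (real n / 2)) k /
      (pochhammer (1/2) k * pochhammer (- real n + 1) k * fact k) = real n * hyp_term n k"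
    if "2 * k \<le> n" for k
    using that
  proof (induction k)
    case 0
    then show ?case
      using assms by (cases n) (simp_all add: hyp_term_def)
  next
    case (Suc k)
    define m where "m = n - 2 * Suc k"
    have n: "n = 2 * k + m + 2"
      using Suc by (simp add: m_def)
    define T where "T k = pochhammer 1 k * pochhammer (- (real n / 2) + 1/2) k * pochhammer (- (real n / 2)) k /
      (pochhammer (1/2) k * pochhammer (- real n + 1) k * fact k)" for k
    have "T (Suc k) = T k * ((- (real n / 2) + 1/2 + k) * (- (real n / 2) + k) / ((1/2 + k) * (- real n + 1 + k)))"
      by (simp add: T_def pochhammer_Suc mult_ac flip: pochhammer_fact)
    also have "T k = real n * hyp_term n k"
      using Suc by (simp add: T_def)
    also have "(- (real n / 2) + 1/2 + k) * (- (real n / 2) + k) / ((1/2 + k) * (- real n + 1 + k))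
       = - ((real m + 2) * (real m + 1) / (2 * (2 * real k + 1) * (real k + real m + 1)))"
    proof -
      have "- (real n / 2) + 1/2 + k = - (real m + 1) / 2" "- (real n / 2) + k = - (real m + 2) / 2"
        "- real n + 1 + k = - (real k + real m + 1)" "1/2 + real k = (2 * real k + 1) / 2"
        by (simp_all add: n field_simps)
      moreover have "(- a / 2) * (- b / 2) / ((d / 2) * (- c)) = - (b * a / (2 * d * c))" for a b c d :: real
        by (simp add: mult_ac)
      ultimately show ?thesis
        by (simp only:)
    qed
    also have "real n * hyp_term n k * - ((real m + 2) * (real m + 1) / (2 * (2 * real k + 1) * (real k + real m + 1)))
       = real n * hyp_term n (Suc k)"
      by (simp add: n hyp_term_def divide_simps) (simp add: algebra_simps)
    finally show ?case
      by (simp add: T_def)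
  qed
  have "lam n = - (\<Sum>k\<le>n div 2. real n * hyp_term n k)"
    unfolding lam_def atMost_atLeast0
    by (intro arg_cong[of _ _ uminus] sum.cong refl summand) auto
  also have "(\<Sum>k\<le>n div 2. real n * hyp_term n k) = (\<Sum>k\<le>N. real n * hyp_term n k)"
    using assms by (intro sum.mono_neutral_left) (auto simp: hyp_term_def)
  finally show ?thesis
    by (simp add: sum_distrib_left sum_negf)
qed

text \<open>Zeilberger's algorithm supplies the recurrence, and Gosper's algorithm the closed form of the
  partial sums in its proof.\<close>

lemma lam_Suc:
  assumes "n \<ge> 3"
  shows "lam (Suc n) = (2 + real (Suc n) * lam n) / (2 * real n)"
proof -
  \<comment> \<open>After extracting the common factor, (n - k) - (n + 1 - 2k)/2 remains; there
    \<open>k\<close> cancels and (n - 1)/2 is left.\<close>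
  define W where "W k = (- 1) ^ k * fact k * fact (n - 1 - k) / (fact (2 * k) * fact (n + 1 - 2 * k))
    * ((real n - 1) / 2)" for k
  have W: "hyp_term (Suc n) k - hyp_term n k / 2 = W k" if k: "2 * k \<le> n + 1" for k
  proof (cases "2 * k = n + 1")
    \<comment> \<open>Only in this case does \<open>hyp_term n k\<close> take its default value
      0.\<close>
    case True
    then obtain r where "k = Suc (Suc r)" "n = 2 * r + 3"
      using assms by (cases k; cases "k - 1") auto
    then show ?thesis
      by (simp add: hyp_term_def W_def divide_simps) (simp add: algebra_simps)?
  next
    case False
    define m where "m = n - 2 * k"
    have n: "n = 2 * k + m"
      using k False by (simp add: m_def)
    obtain r where r: "k + m = Suc r"
      using assms n by (cases "k + m") auto
    have "n - 1 - k = r" "n - k = Suc r" "n + 1 - 2 * k = Suc m" "n - 2 * k = m" "2 * k \<le> n"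
      "real n = real k + real r + 1"  "real r = real k + real m - 1"
      using n r by simp_all
    then show ?thesis
      by (simp add: hyp_term_def W_def divide_simps) (simp add: algebra_simps)
  qed
  have partial: "(\<Sum>k\<le>K. W k) = - 1 / (real n * (real n + 1))
      + (real n + 1 - 2 * real K) * (real n - 2 * real K) / (real n * (real n - 1)) * W K"
    if "2 * K \<le> n + 1" for K
    using that
  proof (induction K)
    case 0
    obtain r where "n = Suc (Suc r)"
      using assms by (cases n; cases "n - 1") auto
    then show ?case
      by (simp add: W_def divide_simps) (simp add: algebra_simps)
  next
    case (Suc K)
    define m where "m = n + 1 - 2 * Suc K"
    have n: "n = 2 * K + m + 1"
      using Suc by (simp add: m_def)
    obtain r where r: "K + m = Suc r"
      using n assms by (cases "K + m") auto
    have "n - 1 - K = Suc r" "n - 1 - Suc K = r" "n + 1 - 2 * K = Suc (Suc m)" "n + 1 - 2 * Suc K = m"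
      using n r by simp_all
    then have "W (Suc K) * (2 * (real r + 1) * (2 * real K + 1)) = - W K * ((real m + 2) * (real m + 1))"
      by (simp add: W_def divide_simps) (simp add: algebra_simps)
    moreover have "real r = real K + real m - 1"
      using r by simp
    ultimately have ratio: "W K * ((real m + 2) * (real m + 1))
        = - W (Suc K) * (2 * (real K + real m) * (2 * real K + 1))"
      by simp
    have "(\<Sum>k\<le>Suc K. W k) = - 1 / (real n * (real n + 1))
      + W K * ((real m + 2) * (real m + 1)) / (real n * (real n - 1)) + W (Suc K)"
      using Suc by (simp add: n mult_ac) (simp add: algebra_simps)
    also have "\<dots> = - 1 / (real n * (real n + 1))
      + real m * (real m - 1) / (real n * (real n - 1)) * W (Suc K)"
    proof -
      have "real n * (real n - 1) \<noteq> 0"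
        using assms by simp
      then have "W (Suc K) = (real n * (real n - 1)) * W (Suc K) / (real n * (real n - 1))"
        by simp
      moreover have "- W (Suc K) * (2 * (real K + real m) * (2 * real K + 1)) + (real n * (real n - 1)) * W (Suc K)
         = real m * (real m - 1) * W (Suc K)"
        by (simp add: n algebra_simps)
      ultimately show ?thesis
        unfolding ratio by (metis (no_types) add.assoc add_divide_distrib times_divide_eq_left)
    qed
    finally show ?case
      by (simp add: n algebra_simps)
  qed
  \<comment> \<open>At this endpoint one factor of the closed form vanishes: the first for odd
    \<open>n\<close>, the second for even \<open>n\<close>. Both \<open>hyp_term\<close> sums are
    complete up to \<open>K\<close>.\<close>
  define K where "K = (n + 1) div 2"
  have "(real n + 1 - 2 * real K) * (real n - 2 * real K) = 0"
    unfolding K_def by (cases "even n") (auto elim!: evenE oddE)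
  then have "(\<Sum>k\<le>K. W k) = - 1 / (real n * (real n + 1))"
    using partial[of K] by (simp add: K_def)
  moreover have "(\<Sum>k\<le>K. W k) = (\<Sum>k\<le>K. hyp_term (Suc n) k) - (\<Sum>k\<le>K. hyp_term n k) / 2"
    unfolding sum_divide_distrib sum_subtractf[symmetric]
    by (intro sum.cong refl W[symmetric]) (auto simp: K_def)
  moreover have "lam (Suc n) = - real (Suc n) * (\<Sum>k\<le>K. hyp_term (Suc n) k)"
    "lam n = - real n * (\<Sum>k\<le>K. hyp_term n k)"
    using assms by (intro lam_eq_sum_hyp_term; simp add: K_def)+
  ultimately show ?thesis
    using assms by (simp add: divide_simps) (simp add: algebra_simps)
qed

lemma lam_3: "lam 3 = 1 / 2"
proof -
  have "{0..3 div 2} = {0, 1::nat}"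
    by auto
  then show ?thesis
    by (simp add: lam_def)
qed

text \<open>Induction along \<open>lam_Suc\<close>. The bound 1 persists because n + 1 <= 2n - 2 for
  n >= 3. The constant 12 is the least one for which the step of the last bound closes at n = 3,
  where it holds with equality. Nonnegativity turns that bound into one on the norm.\<close>

lemma lam_bounds:
  assumes "n \<ge> 3"
  shows "0 \<le> lam n \<and> lam n \<le> 1 \<and> lam n \<le> 12 / real n"
  using assms
proof (induction n rule: nat_induct_at_least)
  case base
  then show ?case
    by (simp add: lam_3)
next
  case (Suc n)
  have n: "real n \<ge> 3"
    using Suc by simp
  have "(1 + real n) * lam n \<le> (1 + real n) * 1"
    using Suc by (intro mult_left_mono) auto
  also have "\<dots> \<le> 2 * real n - 2"
    using n by simp
  finally have 1: "lam (Suc n) \<le> 1"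
    unfolding lam_Suc[OF Suc.hyps] using n by (simp add: divide_simps)
  have "lam n * real n \<le> 12"
    using Suc n by (simp add: field_simps)
  then have "(real n + 1) * (2 * real n + (real n + 1) * (lam n * real n)) 
      \<le> (real n + 1) * (2 * real n + (real n + 1) * 12)"
    using n by (intro mult_left_mono add_left_mono) auto
  also have "\<dots> \<le> 24 * (real n * real n)"
  proof -
    have "(real n - 3) * (10 * real n + 4) \<ge> 0"
      using n by simp
    then show ?thesis by (simp add: algebra_simps)
  qed
  finally have "real n * ((real n + 1) * (2 + (real n + 1) * lam n)) \<le> real n * (24 * real n)"
    by (simp add: algebra_simps)
  then have "(real n + 1) * (2 + (real n + 1) * lam n) \<le> 24 * real n"
    by (rule mult_left_le_imp_le) (use n in simp)
  then have "(2 + real (Suc n) * lam n) / (2 * real n) \<le> 12 / real (Suc n)"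
    using n by (simp add: divide_simps) (simp add: algebra_simps)
  then show ?case
    using 1 Suc n unfolding lam_Suc[OF Suc.hyps] by simp
qed

section \<open>The trinomial product over the roots of unity\<close>

text \<open>If \<open>X + s Y = 1\<close> and \<open>X Y = t\<close>, then \<open>1 + t cnj w + s w = (X + s w) (1 + Y cnj w)\<close>
  on the unit circle, so the product over the roots of unity splits.\<close>

lemma prod_trinomial_roots_of_unity:
  fixes s t :: complex
  assumes "n > 0"
  shows "(\<Prod>k=1..n. 1 + t * cnj (cis (2 * pi * real k / real n)) + s * cis (2 * pi * real k / real n))
       = poly (lucas n) (s * t) - (- s) ^ n - (- t) ^ n"
proof -
  let ?w = "\<lambda>k. cis (2 * pi * real k / real n)"
  \<comment> \<open>\<open>Y\<close> is a root of s Y^2 - Y + t, given by the quadratic formula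
    unless \<open>s = 0\<close>, when \<open>Y = t\<close>.\<close>
  have "\<exists>Y. (1 - s * Y) * Y = t"
  proof (cases "s = 0")
    case False
    define Y where "Y = (1 - csqrt (1 - 4 * s * t)) / (2 * s)"
    have "1 - s * Y = (1 + csqrt (1 - 4 * s * t)) / 2"
      using False by (simp add: Y_def field_simps)
    then have "(1 - s * Y) * Y = (1 - csqrt (1 - 4 * s * t) ^ 2) / (4 * s)"
      using False by (simp add: Y_def power2_eq_square field_simps)
    then show ?thesis
      using False by auto
  qed simp
  then obtain Y where Y: "(1 - s * Y) * Y = t"
    by blast
  define X where "X = 1 - s * Y"
  have "X * Y = t" "X + s * Y = 1"
    using Y by (simp_all add: X_def)
  have unit: "cnj (?w k) * ?w k = 1" for k
    by (simp add: cis_cnj flip: cis_inverse)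
  \<comment> \<open>Writing the second factor as a conjugate makes
    \<open>prod_diff_roots_of_unity\<close> applicable to it too.\<close>
  have "(\<Prod>k=1..n. 1 + t * cnj (?w k) + s * ?w k)
      = (\<Prod>k=1..n. (X - ?w k * (- s)) * cnj (1 - ?w k * cnj (- Y)))"
  proof (rule prod.cong[OF refl])
    fix k
    have "(X - ?w k * (- s)) * cnj (1 - ?w k * cnj (- Y))
        = X + s * Y * (cnj (?w k) * ?w k) + X * Y * cnj (?w k) + s * ?w k"
      by (simp add: algebra_simps)
    then show "1 + t * cnj (?w k) + s * ?w k = (X - ?w k * (- s)) * cnj (1 - ?w k * cnj (- Y))"
      unfolding unit \<open>X * Y = t\<close> using \<open>X + s * Y = 1\<close> by simp
  qed
  also have "\<dots> = (X ^ n - (- s) ^ n) * cnj (1 ^ n - cnj (- Y) ^ n)"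
    unfolding prod.distrib cnj_prod[symmetric] prod_diff_roots_of_unity[OF assms] ..
  also have "\<dots> = X ^ n + (s * Y) ^ n - (- s) ^ n - (- t) ^ n"
    unfolding \<open>X * Y = t\<close>[symmetric]
    by (simp add: power_minus[of s] power_minus[of Y] power_minus[of "X * Y"] power_mult_distrib
        algebra_simps flip: power_mult_distrib[of "- 1 :: complex"])
  \<comment> \<open>\<open>X\<close> and \<open>s * Y\<close> have sum 1 and product
    \<open>s * t\<close>.\<close>
  also have "X ^ n + (s * Y) ^ n = poly (lucas n) (s * t)"
    using poly_lucas[OF \<open>X + s * Y = 1\<close>, of n] unfolding \<open>X * Y = t\<close>[symmetric]
    by (simp add: mult_ac)
  finally show ?thesis .
qed

text \<open>Lifts the identity of values to one of polynomials, from which coefficients can be read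
  off.\<close>

lemma prod_trinomial_roots_of_unity_poly:
  assumes "n > 0"
  shows "(\<Prod>k=1..n. [:[:1, cnj (cis (2 * pi * real k / real n)):], [:cis (2 * pi * real k / real n):]:])
       = (\<Sum>k\<le>n. monom (monom (poly.coeff (lucas n) k) k) k)
         - monom [:(- 1) ^ n:] n - [:monom ((- 1) ^ n) n:]"
proof (rule bivariate_poly_eqI)
  fix s t :: complex
  let ?w = "\<lambda>k. cis (2 * pi * real k / real n)"
  have "degree (lucas n) \<le> n"
    using assms by (intro degree_le) (simp add: coeff_lucas)
  then have "poly (lucas n) (s * t) = (\<Sum>k\<le>n. poly.coeff (lucas n) k * (s * t) ^ k)"
    unfolding poly_altdef by (intro sum.mono_neutral_left) (auto simp: coeff_eq_0)
  moreover have "poly (poly (\<Prod>k=1..n. [:[:1, cnj (?w k):], [:?w k:]:]) [:s:]) t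
    = (\<Prod>k=1..n. 1 + t * cnj (?w k) + s * ?w k)"
    by (simp add: poly_prod algebra_simps)
  ultimately show "poly (poly (\<Prod>k=1..n. [:[:1, cnj (?w k):], [:?w k:]:]) [:s:]) t
    = poly (poly ((\<Sum>k\<le>n. monom (monom (poly.coeff (lucas n) k) k) k)
         - monom [:(- 1) ^ n:] n - [:monom ((- 1) ^ n) n:]) [:s:]) t"
    unfolding prod_trinomial_roots_of_unity[OF assms]
    by (simp add: poly_sum poly_monom power_mult_distrib mult_ac power_minus[of s] power_minus[of t])
qed

text \<open>Off the diagonal only the positions (n, 0) and (0, n) can be nonzero;
  \<open>n \<ge> 2\<close> keeps (k + 1, k) away from both.\<close>

lemma esym_roots_of_unity:
  fixes n :: nat
  defines "w \<equiv> \<lambda>k. cis (2 * pi * real k / real n)"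
  assumes "n \<ge> 2"
  shows "k \<le> n \<Longrightarrow> esym w {1..n} k k = poly.coeff (lucas n) k" and "esym w {1..n} (Suc k) k = 0"
proof -
  have n: "n > 0"
    using assms by simp
  have coeff: "esym w {1..n} a b = (if a = b \<and> a \<le> n then poly.coeff (lucas n) a else 0)
      - (if a = n \<and> b = 0 then (- 1) ^ n else 0) - (if a = 0 \<and> b = n then (- 1) ^ n else 0)" for a b
  proof -
    have "(\<Sum>k\<le>n. poly.coeff (poly.coeff (monom (monom (poly.coeff (lucas n) k) k) k) a) b)
        = (\<Sum>k\<le>n. if k = a then (if a = b then poly.coeff (lucas n) a else 0) else 0)"
      by (intro sum.cong) auto
    then show ?thesis
      unfolding esym_def w_def prod_trinomial_roots_of_unity_poly[OF n]
      by (auto simp: coeff_sum coeff_pCons split: nat.split)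
  qed
  show "k \<le> n \<Longrightarrow> esym w {1..n} k k = poly.coeff (lucas n) k"
    using n by (auto simp: coeff simp del: One_nat_def)
  show "esym w {1..n} (Suc k) k = 0"
    using assms(2) by (simp add: coeff del: One_nat_def)
qed

section \<open>Averaging over the symmetric group\<close>

theorem theorem3p5:
  shows "(\<forall>n::nat. n \<ge> 3 \<longrightarrow>
            (1 / fact n :: real) *\<^sub>R
              (\<Sum>\<sigma> | \<sigma> permutes {1..n}. mat_prod_upto n (\<lambda>i. outer_self (avec n (\<sigma> i))))
            = (- lam n * 2 powr (- real n)) *\<^sub>R (mat 1 :: real^2^2))
       \<and> (\<forall>n::nat. n \<ge> 3 \<longrightarrow> lam n \<le> 1)
       \<and> lam \<in> O(\<lambda>n. 1 / real n)"
proof (intro conjI allI impI)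
  fix n :: nat
  assume n: "n \<ge> 3"
  define w where "w = (\<lambda>k. cis (2 * pi * real k / real n))"
  let ?F = "\<lambda>xs. foldr (**) (map (\<lambda>k. (1/2) *\<^sub>R cmat 1 (w k)) xs) (mat 1)"
  have set: "set [1..<Suc n] = {1..n}"
    by auto
  have "(\<Sum>\<sigma> | \<sigma> permutes {1..n}. mat_prod_upto n (\<lambda>i. outer_self (avec n (\<sigma> i))))
      = (\<Sum>\<sigma> | \<sigma> permutes {1..n}. ?F (map \<sigma> [1..<Suc n]))"
    by (simp add: mat_prod_upto_def outer_self_avec w_def o_def del: upt_Suc)
  also have "\<dots> = (\<Sum>xs\<in>permutations_of_set {1..n}. ?F xs)"
    using bij_betw_permutes_permutations_of_set[OF distinct_upt, of 1 "Suc n"]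
    unfolding set by (rule sum.reindex_bij_betw)
  also have "\<dots> = (fact n / 2 ^ n) *\<^sub>R cmat (lin_coeff w n {1..n}) (antilin_coeff w n {1..n})"
    using sum_orderings_cmat[of "{1..n}" n w] by simp
  also have "antilin_coeff w n {1..n} = 0"
    using esym_roots_of_unity(2)[of n] n by (simp add: antilin_coeff_def w_def)
  also have "lin_coeff w n {1..n} = of_real (- lam n)"
  proof -
    have "lin_coeff w n {1..n} = (\<Sum>k\<le>n. of_real (real n * hyp_term n k))"
      unfolding lin_coeff_def
    proof (rule sum.cong[OF refl])
      fix k assume "k \<in> {..n}"
      then have "esym w {1..n} k k = poly.coeff (lucas n) k"
        using esym_roots_of_unity(1)[of n k] n by (simp add: w_def)
      moreover have "fact k ^ 2 / fact (2 * k) * (if 2 * k \<le> n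
          then (- 1) ^ k * real n * fact (n - k - 1) / (fact k * fact (n - 2 * k)) else 0)
        = real n * hyp_term n k"
        by (simp add: hyp_term_def power2_eq_square mult_ac)
      ultimately show "of_real (fact k ^ 2 / fact (2 * k)) * esym w {1..n} k k
        = complex_of_real (real n * hyp_term n k)"
        using n by (simp only: coeff_lucas of_real_mult[symmetric])
    qed
    also have "\<dots> = of_real (- lam n)"
      using n lam_eq_sum_hyp_term[of n n] by (simp add: sum_negf flip: sum_distrib_left)
    finally show ?thesis .
  qed
  also have "cmat (of_real (- lam n)) 0 = (- lam n) *\<^sub>R mat 1"
    by (simp only: cmat_scaleR flip: cmat_one) (simp add: scaleR_conv_of_real)
  finally show "(1 / fact n :: real) *\<^sub>R
      (\<Sum>\<sigma> | \<sigma> permutes {1..n}. mat_prod_upto n (\<lambda>i. outer_self (avec n (\<sigma> i))))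
    = (- lam n * 2 powr (- real n)) *\<^sub>R (mat 1 :: real^2^2)"
    by (simp add: powr_minus powr_realpow divide_inverse mult_ac)
next
  fix n :: nat
  assume "n \<ge> 3"
  then show "lam n \<le> 1"
    using lam_bounds by simp
next
  show "lam \<in> O(\<lambda>n. 1 / real n)"
  proof (rule bigoI)
    show "\<forall>\<^sub>F n in at_top. norm (lam n) \<le> 12 * norm (1 / real n)"
      using eventually_ge_at_top[of 3] by eventually_elim (use lam_bounds in auto)
  qed
qed

end
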